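(* Define functions $\widetilde{h}_n(\tau)$, $n\geq0$, by the Laurent expansion in $w=2\pi i z$ \[ \frac{1}{\theta_1(z,\tau)} = \frac{1}{w} \sum_{n \geq 0} \widetilde{h}_n(\tau) w^{n}, \] let $h_n = n!\, \widetilde{h}_n(\tau)\, \theta_1^{\bullet}(0,\tau)$, and for $n\geq 0$ set \[ F_n(z, \tau) = \frac{1}{\theta_1(z,\tau)} \sum_{k = 0}^n \binom{n}{k} h_{n-k}(\tau)\, \theta_1^{k\bullet}(z,\tau), \] where $\theta_1^{k\bullet}$ denotes the $k$-th derivative $\big(\frac{1}{2\pi i}\frac{\partial}{\partial z}\big)^k\theta_1$. Then $F_n = J_n$ for all $n \geq 0$.
   Context: Let $\tau\in\mathbb{H}$, $z\in\mathbb{C}$, $q=e^{2\pi i\tau}$, $p=e^{2\pi iz}$. $\theta_1(z,\tau) = -i q^{1/8} (p^{1/2} - p^{-1/2}) \prod_{m \geq 1} (1 - q^m) (1 - p q^m) (1 - p^{-1} q^m)$, $\theta_1^\bullet=\frac{1}{2\pi i}\partial_z\theta_1$. Bernoulli numbers: $x/(e^x-1)=\sum B_nx^n/n!$. For $n\geq0$, $J_n(z,\tau) = \delta_{n,1} \frac{p}{p - 1} + B_n - n \sum_{k, r \geq 1} r^{n - 1} (p^k + (-1)^n p^{-k}) q^{k r}$ (meromorphically continued in $z$). *)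

theory Defs
  imports "HOL-Complex_Analysis.Complex_Analysis"
begin

text \<open>
  Branches of the fractional powers of \<open>q = exp (2\<pi>i\<tau>)\<close> and \<open>p = exp (2\<pi>iz)\<close> in \<open>theta1\<close>:
  \<open>q^(1/8) = exp (2\<pi>i\<tau>/8)\<close>, \<open>p^(1/2) = exp (\<pi>iz)\<close> and \<open>p^(-1/2) = exp (-\<pi>iz)\<close>.
\<close>

definition qvar :: "complex \<Rightarrow> complex" where
  "qvar \<tau> = exp (2 * pi * \<i> * \<tau>)"

definition pvar :: "complex \<Rightarrow> complex" where
  "pvar z = exp (2 * pi * \<i> * z)"

definition theta1 :: "complex \<Rightarrow> complex \<Rightarrow> complex" where
  "theta1 z \<tau> = - \<i> * exp (2 * pi * \<i> * \<tau> / 8) * (exp (pi * \<i> * z) - exp (- (pi * \<i> * z))) *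
     (\<Prod>m. (1 - qvar \<tau> ^ Suc m) * (1 - pvar z * qvar \<tau> ^ Suc m) *
            (1 - inverse (pvar z) * qvar \<tau> ^ Suc m))"

definition theta1_bullet :: "nat \<Rightarrow> complex \<Rightarrow> complex \<Rightarrow> complex" where
  "theta1_bullet k z \<tau> = (1 / (2 * pi * \<i>)) ^ k * (deriv ^^ k) (\<lambda>u. theta1 u \<tau>) z"

text \<open>
  \<open>B\<^sub>n\<close> with the convention \<open>B\<^sub>1 = -1/2\<close>. Division of formal power series cancels the common
  factor \<open>X\<close> of numerator and denominator.
\<close>

definition bernoulli_num :: "nat \<Rightarrow> complex" where
  "bernoulli_num n = fact n * fps_nth (fps_X / (fps_exp 1 - 1)) n"

text \<open>
  The double series converges absolutely for \<open>\<bar>q\<bar> < \<bar>p\<bar> < 1/\<bar>q\<bar>\<close>, i.e. \<open>\<bar>Im z\<bar> < Im \<tau>\<close>.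
\<close>

definition J_series :: "nat \<Rightarrow> complex \<Rightarrow> complex \<Rightarrow> complex" where
  "J_series n z \<tau> =
     (if n = 1 then pvar z / (pvar z - 1) else 0) + bernoulli_num n
     - of_nat n * (\<Sum>\<^sub>\<infinity>(k, r)\<in>{1..}\<times>{1..}. of_nat r ^ (n - 1) *
         (pvar z ^ k + (- 1) ^ n * inverse (pvar z) ^ k) * qvar \<tau> ^ (k * r))"

text \<open>
  Meromorphic functions are represented by their \<open>nicely_meromorphic_on\<close> representatives
  (no removable singularities, value \<open>0\<close> at poles), which makes the continuation unique. Integers
  are left out of the comparison since \<open>J\<^sub>1\<close> has a pole there.
\<close>

definition is_J_continuation :: "nat \<Rightarrow> complex \<Rightarrow> (complex \<Rightarrow> complex) \<Rightarrow> bool" where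
  "is_J_continuation n \<tau> f \<longleftrightarrow>
     f nicely_meromorphic_on UNIV \<and>
     (\<forall>z. \<bar>Im z\<bar> < Im \<tau> \<and> z \<notin> \<int> \<longrightarrow> f z = J_series n z \<tau>)"

definition J :: "nat \<Rightarrow> complex \<Rightarrow> complex \<Rightarrow> complex" where
  "J n z \<tau> = (THE f. is_J_continuation n \<tau> f) z"

lemma is_J_continuation_unique:
  assumes "Im \<tau> > 0" "is_J_continuation n \<tau> f" "is_J_continuation n \<tau> g"
  shows "f = g"
proof -
  define h where "h = (\<lambda>z. f z - g z)"
  have f: "f nicely_meromorphic_on UNIV" and g: "g nicely_meromorphic_on UNIV"
    using assms by (auto simp: is_J_continuation_def)
  have h: "h meromorphic_on UNIV"
    using f g unfolding h_def nicely_meromorphic_on_def by (intro meromorphic_intros) auto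
  define z0 where "z0 = \<i> * of_real (Im \<tau> / 2)"
  define U where "U = {z. Im z > 0} \<inter> {z. Im z < Im \<tau>}"
  have "open U" unfolding U_def
    by (intro open_Int open_halfspace_Im_lt open_halfspace_Im_gt)
  moreover have "z0 \<in> U" using assms(1) by (simp add: U_def z0_def)
  moreover have "h z = 0" if "z \<in> U" for z
  proof -
    have "Im z > 0" "Im z < Im \<tau>" using that by (auto simp: U_def)
    moreover from this have "z \<notin> \<int>" by (auto elim!: Ints_cases)
    ultimately show ?thesis using assms(2,3) by (simp add: h_def is_J_continuation_def)
  qed
  ultimately have "eventually (\<lambda>z. h z = 0) (at z0)"
    unfolding eventually_at_topological by blast
  moreover have "eventually (\<lambda>z. h z \<noteq> 0) (at z0)" if "\<forall>\<^sub>\<approx>z\<in>UNIV. h z \<noteq> 0"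
    using that by (simp add: eventually_cosparse_imp_eventually_at[where B = UNIV])
  ultimately have "\<not> (\<forall>\<^sub>\<approx>z\<in>UNIV. h z \<noteq> 0)"
    using eventually_conj[of "\<lambda>z. h z = 0" "at z0" "\<lambda>z. h z \<noteq> 0"] by auto
  then have "\<forall>\<^sub>\<approx>z\<in>UNIV. h z = 0"
    using meromorphic_imp_constant_or_avoid[OF h, of 0] by auto
  then have ev: "eventually (\<lambda>w. f w = g w) (at z)" for z
    using eventually_cosparse_imp_eventually_at[where A = UNIV and B = UNIV and x = z
        and P = "\<lambda>z. h z = 0"]
    by (simp add: h_def)
  have "f z = g z" for z
  proof -
    have "remove_sings f z = remove_sings g z"
      by (rule remove_sings_cong) (use ev in auto)
    then show ?thesis
      using f g by (metis UNIV_I remove_sings_eqI remove_sings_at_pole nicely_meromorphic_on_def)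
  qed
  then show ?thesis by auto
qed

text \<open>
  \<open>1/\<theta>\<^sub>1 = w^(-1) \<Sum> h\<^sub>n w^n\<close> in \<open>w = 2\<pi>iz\<close>, so index \<open>n\<close> is the coefficient of \<open>w^(n-1)\<close>.
\<close>

definition h_tilde :: "nat \<Rightarrow> complex \<Rightarrow> complex" where
  "h_tilde n \<tau> =
     fls_nth (laurent_expansion (\<lambda>w. 1 / theta1 (w / (2 * pi * \<i>)) \<tau>) 0) (int n - 1)"

definition h_coeff :: "nat \<Rightarrow> complex \<Rightarrow> complex" where
  "h_coeff n \<tau> = fact n * h_tilde n \<tau> * theta1_bullet 1 0 \<tau>"

text \<open>
  Because \<open>1/0 = 0\<close>, this has the junk value \<open>0\<close> at the zeros of \<open>\<theta>\<^sub>1\<close>, even where the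
  singularity is removable; as a meromorphic function of \<open>z\<close> it is
  \<open>remove_sings (\<lambda>z. F n z \<tau>)\<close>.
\<close>

definition F :: "nat \<Rightarrow> complex \<Rightarrow> complex \<Rightarrow> complex" where
  "F n z \<tau> = 1 / theta1 z \<tau> *
     (\<Sum>k=0..n. of_nat (n choose k) * h_coeff (n - k) \<tau> * theta1_bullet k z \<tau>)"

end

theory Submission
  imports Defs
begin

text \<open>
  With \<open>w = 2\<pi>ix\<close> and \<open>y = exp w\<close>, the generating function \<open>\<Sum> F\<^sub>n w\<^sup>n / n!\<close> is the Kronecker function
  \<open>w \<theta>\<^sub>1\<^sup>\<bullet>(0) \<theta>\<^sub>1(z + x) / (\<theta>\<^sub>1(z) \<theta>\<^sub>1(x))\<close>, and \<open>\<Sum> J\<^sub>n w\<^sup>n / n!\<close> is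
  \<open>w (p / (p - 1) + 1 / (y - 1) - \<Sum> (y\<^sup>r p\<^sup>k - y\<^sup>-\<^sup>r p\<^sup>-\<^sup>k) q\<^sup>k\<^sup>r)\<close>. Both have the same simple pole at \<open>y = 1\<close>, so
  the difference \<open>D\<close> of the two (without the factor \<open>w\<close>) is holomorphic on the annulus
  \<open>|q| < |y| < 1/|q|\<close>, and it satisfies \<open>p D(qy) = D(y)\<close>. Hence \<open>|D(y)| |y|\<^sup>c\<close> is invariant under
  \<open>y \<mapsto> qy\<close> for a real exponent \<open>c\<close> with \<open>|c| < 1\<close>, so it attains its maximum inside the annulus, and
  the maximum modulus principle forces \<open>D = 0\<close> unless \<open>p = 1\<close>. This gives \<open>F\<^sub>n = J\<^sub>n\<close> in the strip
  \<open>|Im z| < Im \<tau>\<close>, which determines the continuation of \<open>J\<^sub>n\<close>.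
\<close>

section \<open>The theta product\<close>

text \<open>The infinite q-Pochhammer symbol. The base comes first so that, for |q| < 1,
  \<open>qpoch q\<close> is an entire function.\<close>

definition qpoch :: "complex \<Rightarrow> complex \<Rightarrow> complex" where
  "qpoch q a = (\<Prod>m. 1 - a * q ^ m)"

lemma abs_summable_qpoch:
  fixes q :: complex
  assumes "norm q < 1"
  shows "summable (\<lambda>m. norm (a * q ^ m))"
  using assms by (auto simp: norm_mult norm_power intro!: summable_mult)

lemma convergent_prod_qpoch:
  fixes q :: complex
  assumes "norm q < 1"
  shows "convergent_prod (\<lambda>m. 1 - a * q ^ m)"
proof (rule abs_convergent_prod_imp_convergent_prod, rule summable_imp_abs_convergent_prod)
  show "summable (\<lambda>m. norm (1 - a * q ^ m - 1))"
    using abs_summable_qpoch[OF assms, of a] by simp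
qed

lemma qpoch_LIMSEQ:
  assumes "norm q < 1"
  shows "(\<lambda>n. \<Prod>m\<le>n. 1 - a * q ^ m) \<longlonglongrightarrow> qpoch q a"
  unfolding qpoch_def using convergent_prod_LIMSEQ[OF convergent_prod_qpoch[OF assms]] .

lemma qpoch_rec:
  assumes "norm q < 1"
  shows "qpoch q a = (1 - a) * qpoch q (a * q)"
proof (rule LIMSEQ_unique)
  show "(\<lambda>n. \<Prod>m\<le>Suc n. 1 - a * q ^ m) \<longlonglongrightarrow> qpoch q a"
    by (rule LIMSEQ_Suc[OF qpoch_LIMSEQ[OF assms]])
  have "(\<Prod>m\<le>Suc n. 1 - a * q ^ m) = (1 - a) * (\<Prod>m\<le>n. 1 - a * q * q ^ m)" for n
    by (subst prod.atMost_Suc_shift) (simp add: mult.assoc)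
  then show "(\<lambda>n. \<Prod>m\<le>Suc n. 1 - a * q ^ m) \<longlonglongrightarrow> (1 - a) * qpoch q (a * q)"
    using tendsto_mult_left[OF qpoch_LIMSEQ[OF assms]] by simp
qed

lemma qpoch_nonzero:
  assumes "norm q < 1" "norm a < 1"
  shows "qpoch q a \<noteq> 0"
  unfolding qpoch_def
proof (rule prodinf_nonzero[OF convergent_prod_qpoch[OF assms(1)]])
  fix m
  have "norm (a * q ^ m) \<le> norm a * 1"
    unfolding norm_mult norm_power using assms
    by (intro mult_left_mono power_le_one) auto
  then show "1 - a * q ^ m \<noteq> 0"
    using assms(2) by auto
qed

text \<open>The partial products are polynomials, and on the closed unit disc about \<open>z\<close>
  the majorant \<open>(|z| + 1) |q|^n\<close> makes them converge uniformly.\<close>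

lemma qpoch_holomorphic:
  assumes "norm q < 1"
  shows "qpoch q holomorphic_on UNIV"
proof (rule holomorphic_uniform_sequence)
  fix z :: complex
  let ?P = "\<lambda>n x. \<Prod>m<n. 1 - x * q ^ m"
  have "uniformly_convergent_on (cball z 1) ?P"
  proof (rule uniformly_convergent_on_prod')
    show "uniformly_convergent_on (cball z 1) (\<lambda>N x. \<Sum>n<N. norm (1 - x * q ^ n - 1))"
    proof (rule Weierstrass_m_test')
      fix n x assume "x \<in> cball z 1"
      then have "norm x \<le> norm z + 1"
        using norm_triangle_ineq2[of x z] by (simp add: dist_norm norm_minus_commute)
      then show "norm (norm (1 - x * q ^ n - 1)) \<le> (norm z + 1) * norm q ^ n"
        by (simp add: norm_mult norm_power mult_right_mono)
    qed (use assms in \<open>auto intro!: summable_mult\<close>)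
  qed (auto intro!: continuous_intros)
  then obtain g where g: "uniform_limit (cball z 1) ?P g sequentially"
    by (auto simp: uniformly_convergent_on_def)
  have "g x = qpoch q x" if "x \<in> cball z 1" for x
  proof (rule LIMSEQ_unique)
    show "(\<lambda>n. ?P (Suc n) x) \<longlonglongrightarrow> g x"
      by (rule LIMSEQ_Suc) (rule tendsto_uniform_limitI[OF g that])
    show "(\<lambda>n. ?P (Suc n) x) \<longlonglongrightarrow> qpoch q x"
      using qpoch_LIMSEQ[OF assms] by (simp add: lessThan_Suc_atMost)
  qed
  then have "uniform_limit (cball z 1) ?P (qpoch q) sequentially"
    using g by (subst uniform_limit_cong'[where g = ?P and h = g, symmetric]) auto
  then show "\<exists>d>0. cball z d \<subseteq> UNIV \<and> uniform_limit (cball z d) ?P (qpoch q) sequentially"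
    by (intro exI[of _ 1]) auto
qed (auto intro!: holomorphic_intros)

lemmas qpoch_holomorphic_comp =
  holomorphic_on_compose_gen[OF _ qpoch_holomorphic, unfolded comp_def, simplified]

definition theta_prod :: "complex \<Rightarrow> complex \<Rightarrow> complex" where
  "theta_prod q y = qpoch q q * qpoch q (y * q) * qpoch q (q / y)"

text \<open>
  The theta function in the variable \<open>y = exp (2\<pi>iz)\<close>, up to the factor \<open>y\<^sup>-\<^sup>1\<^sup>/\<^sup>2\<close> (which is not
  single-valued in \<open>y\<close>) and a constant.
\<close>

definition theta_mult :: "complex \<Rightarrow> complex \<Rightarrow> complex" where
  "theta_mult q y = (y - 1) * theta_prod q y"

text \<open>On this annulus the three arguments \<open>q\<close>, \<open>y * q\<close> and
  \<open>q / y\<close> all lie in the open unit disc.\<close>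

lemma theta_prod_nonzero:
  assumes "norm q < 1" "norm q < norm y" "norm y * norm q < 1"
  shows "theta_prod q y \<noteq> 0"
proof -
  have "norm (q / y) < 1"
    using assms by (auto simp: norm_divide divide_simps)
  then show ?thesis
    unfolding theta_prod_def using assms by (simp add: qpoch_nonzero norm_mult)
qed

lemma theta_prod_holomorphic:
  assumes "norm q < 1"
  shows "theta_prod q holomorphic_on - {0}"
  unfolding theta_prod_def
  by (intro holomorphic_intros qpoch_holomorphic_comp assms) auto

text \<open>The shift trades one factor between the two products in \<open>y\<close>:
  \<open>1 - y * q\<close> is absorbed by one and \<open>1 - 1 / y\<close> is split off from the
  other. Together they leave the multiplier \<open>-1 / y\<close>.\<close>

lemma theta_mult_shift:
  assumes "norm q < 1" "q \<noteq> 0" "y \<noteq> 0"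
  shows "theta_mult q (y * q) = - theta_mult q y / y"
proof -
  have 1: "theta_mult q (y * q) = - qpoch q q * qpoch q (y * q) * qpoch q (1 / y)"
    unfolding theta_mult_def theta_prod_def qpoch_rec[OF assms(1), of "y * q"] using assms
    by (simp add: field_simps)
  have 2: "qpoch q (1 / y) = (1 - 1 / y) * qpoch q (q / y)"
    using qpoch_rec[OF assms(1), of "1 / y"] by simp
  show ?thesis
    unfolding 1 2 using assms by (simp add: theta_mult_def theta_prod_def field_simps)
qed

section \<open>Lambert series\<close>

text \<open>
  For \<open>r \<ge> 1\<close> this is \<open>\<Sum>k\<ge>1. p\<^sup>k q\<^sup>k\<^sup>r\<close>; the sums over \<open>r\<close> below run over all of \<open>\<nat>\<close>, hence the value
  \<open>0\<close> at \<open>r = 0\<close>.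
\<close>

definition lambert_coeff :: "complex \<Rightarrow> complex \<Rightarrow> nat \<Rightarrow> complex" where
  "lambert_coeff p q r = (if r = 0 then 0 else p * q ^ r / (1 - p * q ^ r))"

definition lambert :: "complex \<Rightarrow> complex \<Rightarrow> complex \<Rightarrow> complex" where
  "lambert p q y = (\<Sum>r. lambert_coeff p q r * y ^ r)"

text \<open>This keeps the denominators \<open>1 - p * q ^ r\<close> away from zero. As |p| may
  exceed 1, the bound starts only at \<open>r = 1\<close>.\<close>

lemma norm_mult_power_less_1:
  fixes p q :: complex
  assumes "norm q < 1" "norm p * norm q < 1" "r > 0"
  shows "norm p * norm q ^ r \<le> norm p * norm q" "norm p * norm q ^ r < 1"
proof -
  obtain s where r: "r = Suc s" using assms(3) by (cases r) auto
  have "norm q ^ r \<le> norm q * 1"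
    unfolding r power_Suc using assms by (intro mult_left_mono power_le_one) auto
  then show "norm p * norm q ^ r \<le> norm p * norm q"
    by (intro mult_left_mono) auto
  then show "norm p * norm q ^ r < 1"
    using assms by linarith
qed

lemma norm_lambert_coeff_le:
  assumes "norm q < 1" "norm p * norm q < 1"
  shows "norm (lambert_coeff p q r) \<le> norm p / (1 - norm p * norm q) * norm q ^ r"
proof (cases "r = 0")
  case False
  have "norm (1 - p * q ^ r) \<ge> 1 - norm p * norm q"
    using norm_mult_power_less_1[OF assms, of r] False norm_triangle_ineq2[of 1 "p * q ^ r"]
    by (simp add: norm_mult norm_power)
  then have "norm p * norm q ^ r / norm (1 - p * q ^ r) \<le> norm p * norm q ^ r / (1 - norm p * norm q)"
    using assms by (intro divide_left_mono mult_pos_pos) auto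
  with False show ?thesis
    by (simp add: lambert_coeff_def norm_mult norm_power norm_divide)
qed (use assms in \<open>auto simp: lambert_coeff_def\<close>)

lemma summable_lambert:
  assumes "norm q < 1" "norm p * norm q < 1" "norm y * norm q < 1"
  shows "summable (\<lambda>r. lambert_coeff p q r * y ^ r)"
proof (rule summable_comparison_test')
  show "summable (\<lambda>r. norm p / (1 - norm p * norm q) * (norm y * norm q) ^ r)"
    using assms by (intro summable_mult summable_geometric) auto
  show "norm (lambert_coeff p q r * y ^ r) \<le> norm p / (1 - norm p * norm q) * (norm y * norm q) ^ r"
    for r
    using mult_right_mono[OF norm_lambert_coeff_le[OF assms(1,2), of r], of "norm (y ^ r)"]
    by (simp add: norm_mult norm_power power_mult_distrib mult_ac)
qed

text \<open>With \<open>x = p * q ^ r\<close> the coefficient is \<open>x / (1 - x)\<close>, and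
  \<open>x * x / (1 - x) = x / (1 - x) - x\<close>. The shift thus reproduces the series up to the
  geometric series of \<open>p * (y * q) ^ r\<close> over r \<ge> 1.\<close>

lemma lambert_shift:
  assumes "norm q < 1" "norm p * norm q < 1" "norm y * norm q < 1"
  shows "p * lambert p q (y * q) = lambert p q y - p * (y * q) / (1 - y * q)"
proof -
  have "norm (y * q) * norm q \<le> norm (y * q) * 1"
    using assms by (intro mult_left_mono) auto
  then have yq: "norm (y * q) < 1" "norm (y * q) * norm q < 1"
    using assms(3) by (auto simp: norm_mult)
  have coeff: "p * (lambert_coeff p q r * (y * q) ^ r) =
      lambert_coeff p q r * y ^ r - (if r = 0 then 0 else p * (y * q) ^ r)" for r
  proof (cases "r = 0")
    case False
    have "norm (p * q ^ r) < 1"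
      using norm_mult_power_less_1(2)[OF assms(1,2), of r] False by (simp add: norm_mult norm_power)
    then have "1 - p * q ^ r \<noteq> 0"
      by auto
    with False show ?thesis
      by (simp add: lambert_coeff_def field_simps power_mult_distrib)
  qed (auto simp: lambert_coeff_def)
  have "(\<lambda>r. p * (y * q) ^ Suc r) sums (p * (y * q) * (1 / (1 - y * q)))"
    using sums_mult[OF geometric_sums[OF yq(1)], of "p * (y * q)"] by (simp add: mult_ac)
  then have "(\<lambda>r. if r = 0 then 0 else p * (y * q) ^ r) sums (p * (y * q) / (1 - y * q))"
    by (subst sums_Suc_iff[symmetric, of "\<lambda>r. if r = 0 then 0 else p * (y * q) ^ r", simplified])
      simp
  then have "(\<lambda>r. lambert_coeff p q r * y ^ r - (if r = 0 then 0 else p * (y * q) ^ r)) sums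
      (lambert p q y - p * (y * q) / (1 - y * q))"
    unfolding lambert_def by (intro sums_diff summable_sums summable_lambert assms)
  moreover have "(\<lambda>r. p * (lambert_coeff p q r * (y * q) ^ r)) sums (p * lambert p q (y * q))"
    unfolding lambert_def by (intro sums_mult summable_sums summable_lambert assms yq)
  ultimately show ?thesis
    unfolding coeff by (rule sums_unique2[symmetric])
qed

lemma lambert_holomorphic:
  assumes "norm q < 1" "norm p * norm q < 1"
  shows "lambert p q holomorphic_on {y :: complex. norm y * norm q < 1}"
  unfolding holomorphic_on_def
proof
  fix y :: complex assume "y \<in> {y. norm y * norm q < 1}"
  then have y: "norm y * norm q < 1" by simp
  obtain K where K: "K > norm y" "K * norm q < 1"
  proof (cases "q = 0")
    case False
    then have "norm y < 1 / norm q" using y by (simp add: field_simps)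
    then obtain K where "norm y < K" "K < 1 / norm q" using dense by blast
    with False show ?thesis by (intro that[of K]) (auto simp: field_simps)
  qed (auto intro: that[of "norm y + 1"])
  have "norm y \<ge> 0" by simp
  with K have "K > 0" by linarith
  have "summable (\<lambda>r. lambert_coeff p q r * of_real K ^ r)"
    using K \<open>K > 0\<close> by (intro summable_lambert assms) auto
  then have "(lambert p q has_field_derivative (\<Sum>n. diffs (lambert_coeff p q) n * y ^ n)) (at y)"
    unfolding lambert_def by (rule termdiffs_strong) (use K \<open>K > 0\<close> in auto)
  then show "lambert p q field_differentiable at y within {y. norm y * norm q < 1}"
    using field_differentiable_def field_differentiable_at_within by blast
qed

section \<open>Kronecker's identity\<close>

text \<open>The annulus covers two periods of y \<mapsto> qy. The functional equation is assumed for
  1 < |y| < 1/|q|, where \<open>y\<close> and \<open>y * q\<close> both lie in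
  \<open>A\<close>.\<close>

lemma quasiperiodic_annulus_eq_0:
  fixes p q :: complex
  defines "A \<equiv> {y :: complex. norm q < norm y \<and> norm y * norm q < 1}"
  assumes q: "q \<noteq> 0" "norm q < 1" and p: "norm q < norm p" "norm p * norm q < 1" "p \<noteq> 1"
  assumes holo: "D holomorphic_on A"
  assumes shift: "\<And>y. 1 < norm y \<Longrightarrow> norm y * norm q < 1 \<Longrightarrow> p * D (y * q) = D y"
  assumes y: "y \<in> A"
  shows "D y = 0"
proof -
  \<comment> \<open>With this \<open>s\<close> the ring s \<le> |y| \<le> 1/s is exactly one period
    wide and compact inside \<open>A\<close>.\<close>
  define s where "s = sqrt (norm q)"
  define l where "l = ln (norm q)"
  define c where "c = ln (norm p) / l"
  have s: "s * s = norm q" "0 < s" "s < 1"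
    using q by (auto simp: s_def)
  have ss: "s * s < s" using mult_strict_left_mono[of s 1 s] s by linarith
  have l: "l < 0" "exp l = norm q" using q by (auto simp: l_def)
  have p0: "norm p > 0" using p(1) norm_ge_zero[of q] by linarith
  have "ln (norm q) < ln (norm p)" using p0 q p by simp
  moreover have "ln (norm p * norm q) < 0" using p0 q p by simp
  \<comment> \<open>This restates |q| < |p| < 1/|q|. It is what later leaves 0 as the only possible
    integer value of \<open>c\<close>.\<close>
  ultimately have c: "\<bar>c\<bar> < 1"
    using l p0 q by (auto simp: c_def l_def ln_mult abs_less_iff field_simps)
  have qc: "norm q powr c = norm p"
    using l p0 q by (simp add: c_def powr_def l_def)
  \<comment> \<open>\<open>c\<close> is chosen so that \<open>|q|\<^sup>c = |p|\<close>, which makes \<open>N\<close> invariant under \<open>y \<mapsto> qy\<close>\<close>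
  define N where "N y = norm (D y) * norm y powr c" for y
  have N_shift: "N (y * q) = N y" if "1 < norm y" "norm y * norm q < 1" for y
    using shift[OF that] p0
    by (simp add: N_def norm_mult powr_mult qc flip: shift[OF that])
  define K where "K = {y :: complex. s \<le> norm y \<and> norm y * s \<le> 1}"
  have K_eq: "K = cball 0 (1 / s) - ball 0 s"
    using s by (auto simp: K_def field_simps)
  have "compact K"
    unfolding K_eq by (intro compact_diff) auto
  have "1 \<in> K" using s by (auto simp: K_def)
  have "K \<subseteq> A"
  proof
    fix y assume "y \<in> K"
    then have y: "s \<le> norm y" "norm y * s \<le> 1" by (auto simp: K_def)
    have "norm y * s * s \<le> 1 * s"
      using y s by (intro mult_right_mono) auto
    then show "y \<in> A" using y s ss unfolding A_def by (simp add: mult.assoc)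
  qed
  have "continuous_on K D"
    using holo \<open>K \<subseteq> A\<close> holomorphic_on_imp_continuous_on holomorphic_on_subset by blast
  moreover have "norm y \<noteq> 0" if "y \<in> K" for y using that s by (auto simp: K_def)
  ultimately have "continuous_on K N"
    unfolding N_def by (intro continuous_intros) auto
  then obtain y0 where y0: "y0 \<in> K" "\<And>y. y \<in> K \<Longrightarrow> N y \<le> N y0"
    using continuous_attains_sup[of K N] \<open>compact K\<close> \<open>1 \<in> K\<close> by blast
  have N_le: "N y \<le> N y0" if "y \<in> A" for y
  proof -
    have yA: "s * s < norm y" "norm y * (s * s) < 1" using that by (auto simp: A_def s)
    \<comment> \<open>A point of \<open>A\<close> outside \<open>K\<close> is carried into
      \<open>K\<close> by a single multiplication or division by \<open>q\<close>, which preserves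
      \<open>N\<close>.\<close>
    consider "y \<in> K" | "norm y * s > 1" | "norm y < s" by (force simp: K_def)
    then show ?thesis
    proof cases
      case 2
      have "norm y > 1" using 2 s yA
        by (smt (verit) mult_left_le norm_ge_zero)
      have "norm y * s * s > 1 * s" using 2 s by (intro mult_strict_right_mono) auto
      moreover have "norm y * (s * s) * s \<le> norm y * (s * s) * 1" using s by (intro mult_left_mono) auto
      ultimately have "y * q \<in> K" using yA s by (simp add: K_def norm_mult mult.assoc)
      then show ?thesis using y0(2)[of "y * q"] N_shift[of y] \<open>norm y > 1\<close> yA(2) s(1) by simp
    next
      case 3
      have *: "1 < norm (y / q)" "norm (y / q) * norm q < 1" using yA q 3 s
        by (auto simp: norm_divide field_simps)
      have "norm (y / q) * s * s < 1 * s" using 3 s q by (simp add: norm_divide mult.assoc)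
      then have "y / q \<in> K" using * s by (auto simp: K_def)
      then show ?thesis using y0(2) N_shift[OF *] q by auto
    qed (use y0 in auto)
  qed
  define S where "S = {x. Re x > l} \<inter> {x. Re x < - l}"
  \<comment> \<open>The power \<open>y^c\<close> is multivalued on the annulus. Pulled back along
    \<open>exp\<close> to the strip \<open>S\<close> it becomes holomorphic, and the modulus of
    \<open>h\<close> is \<open>N\<close> composed with \<open>exp\<close>.\<close>
  define h where "h x = D (exp x) * exp (of_real c * x)" for x
  have expS: "exp x \<in> A \<longleftrightarrow> x \<in> S" for x
    by (auto simp: A_def S_def simp flip: l(2) exp_add)
  have "open S" "connected S"
    unfolding S_def
    by (auto intro!: open_Int open_halfspace_Re_gt open_halfspace_Re_lt
        convex_connected convex_Int convex_halfspace_Re_gt convex_halfspace_Re_lt)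
  have "h holomorphic_on S"
    unfolding h_def
    by (intro holomorphic_intros holomorphic_on_compose_gen[OF _ holo, unfolded comp_def])
      (auto simp: expS)
  have norm_h: "norm (h x) = N (exp x)" for x
    by (simp add: h_def N_def norm_mult powr_def)
  have "y0 \<noteq> 0" using y0(1) s by (auto simp: K_def)
  have "h constant_on S"
  proof (rule maximum_modulus_principle[OF \<open>h holomorphic_on S\<close> \<open>open S\<close> \<open>connected S\<close> \<open>open S\<close>
        order.refl])
    show "Ln y0 \<in> S" using y0(1) \<open>K \<subseteq> A\<close> \<open>y0 \<noteq> 0\<close> by (auto simp flip: expS)
    show "norm (h z) \<le> norm (h (Ln y0))" if "z \<in> S" for z
      using N_le[of "exp z"] that \<open>y0 \<noteq> 0\<close> by (simp add: norm_h expS)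
  qed
  then obtain k where k: "\<And>x. x \<in> S \<Longrightarrow> h x = k" by (auto simp: constant_on_def)
  have D_exp: "D (exp x) * exp (of_real c * x) = k" if "x \<in> S" for x
    using k[OF that] by (simp add: h_def)
  have "y \<noteq> 0" using y by (auto simp: A_def)
  then have y_exp: "y = exp (Ln y)" "Ln y \<in> S"
    using y expS[of "Ln y"] by simp_all
  have "k = 0"
  \<comment> \<open>The points 0 and 2 pi i of \<open>S\<close> have the same image under
    \<open>exp\<close>, so a nonzero constant forces \<open>c\<close> to be an integer, hence 0.
    Then \<open>D\<close> is constant and the functional equation contradicts p \<noteq> 1.\<close>
  proof (rule ccontr)
    assume "k \<noteq> 0"
    have "D 1 = k" using D_exp[of 0] l by (simp add: S_def)
    moreover have "D 1 * exp (of_real c * (of_real (2 * pi) * \<i>)) = k"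
      using D_exp[of "of_real (2 * pi) * \<i>"] l by (simp add: S_def)
    ultimately have "exp (of_real c * (of_real (2 * pi) * \<i>)) = 1"
      using \<open>k \<noteq> 0\<close> by simp
    then obtain n :: int where "c * (2 * pi) = of_int (2 * n) * pi"
      by (auto simp: exp_eq_1)
    then have "c = of_int n" by simp
    with c have "\<bar>n\<bar> < 1" by linarith
    with \<open>c = of_int n\<close> have "c = 0" by simp
    \<comment> \<open>Halfway between 0 and \<open>- l\<close>: \<open>exp t\<close> has modulus
      |q|^(-1/2), so the functional equation applies there.\<close>
    define t where "t = complex_of_real (- l / 2)"
    have "l + Re t < 0" "Re t > 0" using l by (auto simp: t_def)
    have "t + Ln q \<in> S" using l q by (auto simp: S_def t_def l_def)
    have "Re (Ln q) = l" using q by (simp add: l_def)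
    then have "t \<in> S" "t + Ln q \<in> S" using l(1) by (auto simp: S_def t_def)
    moreover have "exp (t + Ln q) = exp t * q" using q by (simp add: exp_add)
    ultimately have D: "D (exp t) = k" "D (exp t * q) = k"
      using D_exp[of t] D_exp[of "t + Ln q"] \<open>c = 0\<close> by simp_all
    have "p * D (exp t * q) = D (exp t)"
      using \<open>l + Re t < 0\<close> \<open>Re t > 0\<close> by (intro shift) (auto simp flip: l(2) exp_add)
    then show False using D p(3) \<open>k \<noteq> 0\<close> by simp
  qed
  then show ?thesis using D_exp[OF y_exp(2)] y_exp(1) by simp
qed

text \<open>The pole \<open>1 / (y - 1)\<close> and the theta denominators are multiplied out, so
  the identity also covers \<open>y = 1\<close>. The half-integral powers of \<open>p\<close> and
  \<open>y\<close> cancel between the two sides, so \<open>theta_mult\<close> can replace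
  \<open>theta1\<close>.\<close>

lemma kronecker_identity:
  fixes p q y :: complex
  assumes q: "q \<noteq> 0" "norm q < 1" and p: "norm q < norm p" "norm p * norm q < 1" "p \<noteq> 1"
    and y: "norm q < norm y" "norm y * norm q < 1"
  shows "theta_prod q 1 * theta_mult q (p * y) = theta_mult q p * theta_prod q y *
    (1 + (y - 1) * (p / (p - 1) - lambert p q y + lambert (1 / p) q (1 / y)))"
proof -
  define A where "A = {y :: complex. norm q < norm y \<and> norm y * norm q < 1}"
  define H where "H y = theta_prod q 1 * theta_mult q (p * y) / (theta_mult q p * theta_prod q y)" for y
  define R where "R y = p / (p - 1) - lambert p q y + lambert (1 / p) q (1 / y)" for y
  \<comment> \<open>As \<open>H 1 = 1\<close>, this is \<open>H y / (y - 1)\<close> minus the common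
    pole, with the removable singularity at 1 filled in.\<close>
  define M where "M y = (if y = 1 then deriv H 1 else (H y - H 1) / (y - 1))" for y
  define D where "D y = M y - R y" for y
  have p0: "p \<noteq> 0" using p(1) by auto
  have p': "norm (1 / p) * norm q < 1"
    using p p0 by (simp add: norm_divide field_simps)
  have A_eq: "A = {y. norm q < norm y} \<inter> {y. norm y * norm q < 1}" by (auto simp: A_def)
  have "open A" unfolding A_eq by (intro open_Int open_Collect_less continuous_intros)
  have A0: "y \<noteq> 0" if "y \<in> A" for y using that by (auto simp: A_def)
  have nz: "theta_prod q y \<noteq> 0" if "y \<in> A" for y
    using that theta_prod_nonzero q by (auto simp: A_def)
  have "p \<in> A" "1 \<in> A" using p q by (auto simp: A_def)
  have mult_nz: "theta_mult q p \<noteq> 0" using nz \<open>p \<in> A\<close> p by (auto simp: theta_mult_def)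
  have "H holomorphic_on A"
    unfolding H_def theta_mult_def using mult_nz nz p0 A0
    by (intro holomorphic_intros holomorphic_on_compose_gen[OF _ theta_prod_holomorphic[OF q(2)], unfolded comp_def]
        holomorphic_on_subset[OF theta_prod_holomorphic[OF q(2)]]) (auto simp: theta_mult_def)
  then have "M holomorphic_on A"
    unfolding M_def by (rule pole_lemma_open) fact
  moreover have "R holomorphic_on A"
  proof -
    have "lambert p q holomorphic_on A"
      by (rule holomorphic_on_subset[OF lambert_holomorphic]) (use q p in \<open>auto simp: A_def\<close>)
    moreover have "(\<lambda>y. lambert (1 / p) q (1 / y)) holomorphic_on A"
      using q p' A0
      by (intro holomorphic_on_compose_gen[OF _ lambert_holomorphic, unfolded comp_def] holomorphic_intros)
        (auto simp: A_def norm_divide divide_simps)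
    ultimately show ?thesis unfolding R_def by (intro holomorphic_intros)
  qed
  ultimately have "D holomorphic_on A"
    unfolding D_def by (intro holomorphic_intros)
  have H1: "H 1 = 1" using nz[OF \<open>1 \<in> A\<close>] mult_nz by (simp add: H_def)
  have D_shift: "p * D (y * q) = D y" if y: "1 < norm y" "norm y * norm q < 1" for y
  proof -
    have y0: "y \<noteq> 0" "y \<noteq> 1" "y * q \<noteq> 1" using y by (auto simp flip: norm_mult)
    have yA: "y \<in> A" "y * q \<in> A"
    proof -
      show "y \<in> A" using y q by (auto simp: A_def)
      have "norm q * 1 < norm q * norm y" using y q by (intro mult_strict_left_mono) auto
      moreover have "norm (y * q) * norm q \<le> norm (y * q) * 1" using q by (intro mult_left_mono) auto
      ultimately show "y * q \<in> A" using y by (auto simp: A_def norm_mult mult_ac)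
    qed
    \<comment> \<open>The multipliers at \<open>p * y\<close> and at \<open>y\<close> are
      \<open>-1 / (p * y)\<close> and \<open>-1 / y\<close>; their quotient is
      \<open>1 / p\<close>.\<close>
    have quot: "theta_mult q (p * (y * q)) / theta_mult q (y * q) =
        theta_mult q (p * y) / theta_mult q y / p"
      using theta_mult_shift[of q "p * y"] theta_mult_shift[of q y] q p0 y0
      by (simp add: mult.assoc)
    have H_eq: "H w / (w - 1) = theta_prod q 1 / theta_mult q p * (theta_mult q (p * w) / theta_mult q w)" for w
      by (simp add: H_def theta_mult_def)
    have H_shift: "p * (H (y * q) / (y * q - 1)) = H y / (y - 1)"
      unfolding H_eq quot using p0 by simp
    have 1: "p * lambert p q (y * q) = lambert p q y - p * (y * q) / (1 - y * q)"
      by (rule lambert_shift) (use q p y in auto)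
    \<comment> \<open>For the second Lambert series the shift lemma is read backwards, from
      \<open>1 / (y * q)\<close> to \<open>1 / y\<close>.\<close>
    have inv: "1 / (y * q) * q = 1 / y" using q by simp
    have "1 / p * lambert (1 / p) q (1 / (y * q) * q) = lambert (1 / p) q (1 / (y * q)) -
        1 / p * (1 / (y * q) * q) / (1 - 1 / (y * q) * q)"
      by (rule lambert_shift) (use q p' y in \<open>auto simp: norm_divide norm_mult divide_less_eq\<close>)
    then have "lambert (1 / p) q (1 / (y * q)) =
        1 / p * lambert (1 / p) q (1 / y) + 1 / p * (1 / y) / (1 - 1 / y)"
      unfolding inv by (simp add: algebra_simps)
    moreover have "1 / p * (1 / y) / (1 - 1 / y) = 1 / p * (1 / (y - 1))" using y0 p0 by (simp add: divide_simps)
    ultimately have 2: "p * lambert (1 / p) q (1 / (y * q)) = lambert (1 / p) q (1 / y) + 1 / (y - 1)"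
      using p0 by (simp only: ring_distribs mult.assoc[symmetric]) simp
    \<comment> \<open>The geometric correction cancels the pole at \<open>y * q = 1\<close>, leaving
      a constant.\<close>
    have "p * (1 / (y * q - 1) + p / (p - 1)) + p * (y * q) / (1 - y * q) = p / (p - 1)"
      using y0 p by (simp add: divide_simps) (simp add: algebra_simps)
    moreover have "p * (1 / (y * q - 1) + R (y * q)) =
        p * (1 / (y * q - 1) + p / (p - 1)) - p * lambert p q (y * q) + p * lambert (1 / p) q (1 / (y * q))"
      by (simp add: R_def algebra_simps)
    moreover have "a - (l - t) + (m + u) = u + (b - l + m)" if "a + t = b" for a b l m t u :: complex
      using that[symmetric] by simp
    ultimately have R_shift: "p * (1 / (y * q - 1) + R (y * q)) = 1 / (y - 1) + R y"
      unfolding 1 2 R_def by simp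
    show ?thesis
      using H_shift R_shift y0 by (simp add: D_def M_def H1 diff_divide_distrib algebra_simps)
  qed
  have "D y = 0"
    by (rule quasiperiodic_annulus_eq_0[OF q p \<open>D holomorphic_on A\<close>[unfolded A_def]])
      (use D_shift y in auto)
  then have "H y = 1 + (y - 1) * R y"
    using H1 by (auto simp: D_def M_def field_simps split: if_splits)
  moreover have "theta_prod q y \<noteq> 0" using nz y by (auto simp: A_def)
  ultimately show ?thesis
    using mult_nz by (simp add: H_def R_def field_simps)
qed

section \<open>Power series expansions\<close>

text \<open>The Euler operator \<open>y d/dy\<close> multiplies the coefficient of
  \<open>y ^ r\<close> by \<open>r\<close>.\<close>

lemma power_series_times_index:
  fixes c :: "nat \<Rightarrow> complex" and \<rho> :: real
  assumes "\<And>y. norm y < \<rho> \<Longrightarrow> summable (\<lambda>r. c r * y ^ r)" and "norm y < \<rho>"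
  shows "(\<lambda>r. of_nat r * c r * y ^ r) sums (y * (\<Sum>r. diffs c r * y ^ r))"
proof -
  have "summable (\<lambda>r. diffs c r * y ^ r)"
    by (rule termdiff_converges[of y \<rho>]) (use assms in auto)
  from sums_mult[OF diffs_equiv[OF this], of y] show ?thesis
  proof (rule sums_cong[THEN iffD1, rotated])
    show "y * (of_nat r * c r * y ^ (r - Suc 0)) = of_nat r * c r * y ^ r" for r
      by (cases r) auto
  qed
qed

lemma summable_power_series_times_index_power:
  fixes c :: "nat \<Rightarrow> complex" and \<rho> :: real
  assumes "\<And>y. norm y < \<rho> \<Longrightarrow> summable (\<lambda>r. c r * y ^ r)" and "norm y < \<rho>"
  shows "summable (\<lambda>r. of_nat r ^ j * c r * y ^ r)"
  using assms(2)
proof (induction j arbitrary: y)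
  case (Suc j)
  have "summable (\<lambda>r. of_nat r * (of_nat r ^ j * c r) * y ^ r)"
    by (rule sums_summable, rule power_series_times_index) (use Suc in auto)
  then show ?case by (simp add: mult_ac)
qed (use assms in auto)

text \<open>For \<open>y = exp (\<sigma> * w)\<close> the derivative in \<open>w\<close> is \<sigma>
  times the Euler operator in \<open>y\<close>. The two Lambert series in Kronecker's identity use
  \<sigma> = 1 and \<sigma> = -1.\<close>

lemma higher_deriv_power_series_exp:
  fixes c :: "nat \<Rightarrow> complex" and \<rho> :: real
  assumes conv: "\<And>y. norm y < \<rho> \<Longrightarrow> summable (\<lambda>r. c r * y ^ r)" and "norm (exp (\<sigma> * w)) < \<rho>"
  shows "(deriv ^^ j) (\<lambda>w. \<Sum>r. c r * exp (\<sigma> * w) ^ r) w =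
      \<sigma> ^ j * (\<Sum>r. of_nat r ^ j * c r * exp (\<sigma> * w) ^ r)"
  using assms(2)
proof (induction j arbitrary: w)
  case (Suc j)
  let ?f = "\<lambda>w. \<Sum>r. c r * exp (\<sigma> * w) ^ r" and ?c = "\<lambda>r. of_nat r ^ j * c r"
  let ?g = "\<lambda>y. \<Sum>r. ?c r * y ^ r"
  have "open {w. norm (exp (\<sigma> * w)) < \<rho>}"
    by (intro open_Collect_less continuous_intros)
  then have "eventually (\<lambda>w. (deriv ^^ j) ?f w = \<sigma> ^ j * ?g (exp (\<sigma> * w))) (nhds w)"
    using Suc by (intro eventually_mono[OF eventually_nhds_in_open]) auto
  then have "deriv ((deriv ^^ j) ?f) w = deriv (\<lambda>w. \<sigma> ^ j * ?g (exp (\<sigma> * w))) w"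
    by (rule deriv_cong_ev) simp
  also have "\<dots> = \<sigma> ^ j * ((\<Sum>r. diffs ?c r * exp (\<sigma> * w) ^ r) * (\<sigma> * exp (\<sigma> * w)))"
  proof (rule DERIV_imp_deriv, rule DERIV_cmult,
      rule DERIV_chain2[where f = ?g and g = "\<lambda>w. exp (\<sigma> * w)"])
    obtain K where K: "norm (exp (\<sigma> * w)) < K" "K < \<rho>" using dense[OF Suc.prems] by blast
    have "K > 0" using K(1) norm_ge_zero[of "exp (\<sigma> * w)"] by linarith
    show "(?g has_field_derivative (\<Sum>r. diffs ?c r * exp (\<sigma> * w) ^ r)) (at (exp (\<sigma> * w)))"
    proof (rule termdiffs_strong)
      show "summable (\<lambda>r. ?c r * of_real K ^ r)"
        by (rule summable_power_series_times_index_power[OF conv]) (use K \<open>K > 0\<close> in auto)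
    qed (use K \<open>K > 0\<close> in auto)
    show "((\<lambda>w. exp (\<sigma> * w)) has_field_derivative \<sigma> * exp (\<sigma> * w)) (at w)"
      by (auto intro!: derivative_eq_intros)
  qed
  also have "(\<Sum>r. diffs ?c r * exp (\<sigma> * w) ^ r) * (\<sigma> * exp (\<sigma> * w)) =
      \<sigma> * (exp (\<sigma> * w) * (\<Sum>r. diffs ?c r * exp (\<sigma> * w) ^ r))"
    by (simp add: mult_ac)
  also have "exp (\<sigma> * w) * (\<Sum>r. diffs ?c r * exp (\<sigma> * w) ^ r) =
      (\<Sum>r. of_nat r * ?c r * exp (\<sigma> * w) ^ r)"
    using Suc.prems summable_power_series_times_index_power[OF conv]
    by (intro sums_unique power_series_times_index) auto
  finally show ?case by (simp add: mult.assoc)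
qed auto

text \<open>The value at \<open>y = 1\<close> of the \<open>j\<close>-fold Euler operator applied to
  \<open>lambert p q\<close>. For \<open>j = 0\<close> the convention \<open>0 ^ 0 = 1\<close> is
  harmless, as the coefficient at \<open>r = 0\<close> vanishes.\<close>

definition lambert_moment :: "nat \<Rightarrow> complex \<Rightarrow> complex \<Rightarrow> complex" where
  "lambert_moment j p q = (\<Sum>r. of_nat r ^ j * lambert_coeff p q r)"

lemma lambert_exp_has_fps_expansion:
  assumes "q \<noteq> 0" "norm q < 1" "norm p * norm q < 1"
  shows "(\<lambda>w. lambert p q (exp (\<sigma> * w))) has_fps_expansion
    Abs_fps (\<lambda>j. \<sigma> ^ j * lambert_moment j p q / fact j)"
proof -
  define A where "A = {w. norm (exp (\<sigma> * w)) * norm q < 1}"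
  have "open A" "0 \<in> A"
    unfolding A_def using assms by (auto intro!: open_Collect_less continuous_intros)
  moreover have "(\<lambda>w. lambert p q (exp (\<sigma> * w))) holomorphic_on A"
    by (intro holomorphic_on_compose_gen[OF _ lambert_holomorphic, unfolded comp_def] holomorphic_intros assms)
      (auto simp: A_def)
  ultimately have "(\<lambda>w. lambert p q (exp (\<sigma> * w))) has_fps_expansion
      fps_expansion (\<lambda>w. lambert p q (exp (\<sigma> * w))) 0"
    by (rule has_fps_expansion_fps_expansion)
  moreover have "(deriv ^^ j) (\<lambda>w. lambert p q (exp (\<sigma> * w))) 0 = \<sigma> ^ j * lambert_moment j p q" for j
  proof -
    have "(deriv ^^ j) (\<lambda>w. \<Sum>r. lambert_coeff p q r * exp (\<sigma> * w) ^ r) 0 =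
        \<sigma> ^ j * (\<Sum>r. of_nat r ^ j * lambert_coeff p q r * exp (\<sigma> * 0) ^ r)"
      by (rule higher_deriv_power_series_exp[of "1 / norm q"])
        (use assms in \<open>auto intro!: summable_lambert simp: pos_less_divide_eq\<close>)
    then show ?thesis by (simp add: lambert_def lambert_moment_def)
  qed
  ultimately show ?thesis by (simp add: fps_expansion_def)
qed

text \<open>The power series converges at some \<open>K > 1\<close>, hence absolutely at 1.\<close>

lemma abs_summable_lambert_moment:
  assumes "q \<noteq> 0" "norm q < 1" "norm p * norm q < 1"
  shows "summable (\<lambda>r. norm (of_nat r ^ j * lambert_coeff p q r))"
proof -
  obtain K where K: "1 < K" "K < 1 / norm q"
    using dense[of 1 "1 / norm q"] assms by auto
  have "summable (\<lambda>r. of_nat r ^ j * lambert_coeff p q r * of_real K ^ r)"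
    by (rule summable_power_series_times_index_power[of "1 / norm q"])
      (use assms K in \<open>auto intro!: summable_lambert simp: pos_less_divide_eq\<close>)
  from powser_insidea[OF this, of 1] K show ?thesis by simp
qed

section \<open>Lambert moments as double series\<close>

lemma has_sum_geometric_from_1:
  fixes x :: "'a :: {real_normed_field, banach}"
  assumes "norm x < 1"
  shows "((\<lambda>k. x ^ k) has_sum (x / (1 - x))) {1..}"
proof -
  have "((\<lambda>k. x ^ Suc k) has_sum (x * (1 / (1 - x)))) UNIV"
    unfolding power_Suc using assms
    by (intro has_sum_cmult_right norm_summable_imp_has_sum geometric_sums)
      (simp_all add: norm_power)
  then have "((\<lambda>k. x ^ k) has_sum (x / (1 - x))) (Suc ` UNIV)"
    by (subst has_sum_reindex) (auto simp: comp_def)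
  moreover have "Suc ` UNIV = {1..}" by (auto simp: image_iff Suc_le_eq gr0_conv_Suc)
  ultimately show ?thesis by simp
qed

text \<open>Each coefficient is a geometric series in \<open>k\<close>. Reordering is justified by
  absolute summability, which is the same computation for |p| and |q|.\<close>

lemma has_sum_lambert_moment:
  assumes q: "q \<noteq> 0" "norm q < 1" and p: "norm p * norm q < 1"
  shows "((\<lambda>(k, r). of_nat r ^ j * p ^ k * q ^ (k * r)) has_sum lambert_moment j p q) ({1..} \<times> {1..})"
proof -
  let ?f = "\<lambda>(r, k). of_nat r ^ j * p ^ k * q ^ (k * r)"
  have pow: "p ^ k * q ^ (k * r) = (p * q ^ r) ^ k" for k r
    by (simp add: power_mult_distrib mult.commute flip: power_mult)
  have inner: "((\<lambda>k. ?f (r, k)) has_sum (of_nat r ^ j * lambert_coeff p q r)) {1..}" if "r \<in> {1..}" for r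
  proof -
    have "norm (p * q ^ r) < 1"
      using norm_mult_power_less_1[OF q(2) p, of r] that by (simp add: norm_mult norm_power)
    from has_sum_cmult_right[OF has_sum_geometric_from_1[OF this], of "of_nat r ^ j"] show ?thesis
      using that by (simp add: lambert_coeff_def pow mult.assoc)
  qed
  have outer: "((\<lambda>r. of_nat r ^ j * lambert_coeff p q r) has_sum lambert_moment j p q) {1..}"
  proof -
    have s: "summable (\<lambda>r. norm (of_nat r ^ j * lambert_coeff p q r))"
      by (rule abs_summable_lambert_moment[OF q p])
    have "((\<lambda>r. of_nat r ^ j * lambert_coeff p q r) has_sum lambert_moment j p q) UNIV"
      unfolding lambert_moment_def
      by (rule norm_summable_imp_has_sum[OF s summable_sums[OF summable_norm_cancel[OF s]]])
    then show ?thesis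
      by (rule has_sum_cong_neutral[THEN iffD1, rotated -1]) (auto simp: lambert_coeff_def not_less_eq_eq)
  qed
  have "(\<lambda>x. norm (?f x)) summable_on {1..} \<times> {1..}"
  proof (rule summable_on_SigmaI)
    let ?c = "\<lambda>r. lambert_coeff (of_real (norm p)) (of_real (norm q)) r"
    fix r :: nat assume "r \<in> {1..}"
    then have x: "0 \<le> norm p * norm q ^ r" "norm p * norm q ^ r < 1"
      using norm_mult_power_less_1[OF q(2) p, of r] by simp_all
    then have "?c r = of_real (norm p * norm q ^ r / (1 - norm p * norm q ^ r))"
      using \<open>r \<in> {1..}\<close> by (simp add: lambert_coeff_def)
    then have "norm (?c r) = norm p * norm q ^ r / (1 - norm p * norm q ^ r)"
      using x by (simp only: norm_of_real) simp
    with has_sum_cmult_right[OF has_sum_geometric_from_1[of "norm p * norm q ^ r"], of "of_nat r ^ j"]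
    have "((\<lambda>k. of_nat r ^ j * (norm p * norm q ^ r) ^ k) has_sum (norm (of_nat r ^ j * ?c r))) {1..}"
      using x by (simp add: norm_mult norm_power del: of_nat_power)
    then show "((\<lambda>k. norm (?f (r, k))) has_sum (norm (of_nat r ^ j * ?c r))) {1..}"
      by (simp add: norm_mult norm_power power_mult_distrib mult_ac flip: power_mult)
  next
    have "summable (\<lambda>r. norm (of_nat r ^ j * lambert_coeff (of_real (norm p)) (of_real (norm q)) r))"
      by (rule abs_summable_lambert_moment) (use q p in auto)
    then have "(\<lambda>r. norm (of_nat r ^ j * lambert_coeff (of_real (norm p)) (of_real (norm q)) r)) summable_on UNIV"
      by (intro norm_summable_imp_summable_on) simp
    then show "(\<lambda>r. norm (of_nat r ^ j * lambert_coeff (of_real (norm p)) (of_real (norm q)) r)) summable_on {1..}"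
      by (rule summable_on_subset_banach) auto
  qed auto
  then have "?f summable_on {1..} \<times> {1..}"
    by (rule abs_summable_summable)
  from has_sum_SigmaI[OF inner outer this] show ?thesis
    by (subst has_sum_swap) simp
qed

section \<open>Laurent coefficients\<close>

lemma norm_qvar: "norm (qvar \<tau>) = exp (- 2 * pi * Im \<tau>)"
  by (simp add: qvar_def)

lemma norm_pvar: "norm (pvar z) = exp (- 2 * pi * Im z)"
  by (simp add: pvar_def)

lemma pvar_in_annulus:
  assumes "\<bar>Im z\<bar> < Im \<tau>"
  shows "norm (qvar \<tau>) < norm (pvar z)" "norm (pvar z) * norm (qvar \<tau>) < 1"
proof -
  have "pi * \<bar>Im z\<bar> < pi * Im \<tau>" using assms by simp
  then show "norm (qvar \<tau>) < norm (pvar z)" "norm (pvar z) * norm (qvar \<tau>) < 1"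
    by (auto simp: norm_qvar norm_pvar abs_less_iff abs_mult_pos' simp flip: exp_add)
qed

lemma pvar_add: "pvar (z + w) = pvar z * pvar w"
  by (simp add: pvar_def exp_add algebra_simps)

lemma pvar_eq_1_iff: "pvar z = 1 \<longleftrightarrow> z \<in> \<int>"
proof
  assume "pvar z = 1"
  then have "exp (2 * pi * \<i> * z) = 1" by (simp add: pvar_def)
  then obtain n :: int where "Im z = 0" "2 * pi * Re z = of_int (2 * n) * pi"
    by (auto simp: exp_eq_1)
  then have "z = of_int n" by (simp add: complex_eq_iff)
  then show "z \<in> \<int>" by simp
qed (auto elim!: Ints_cases simp: pvar_def exp_eq_1)

section \<open>The theta function in the variable \<open>z\<close>\<close>

definition theta1_const :: "complex \<Rightarrow> complex" where
  "theta1_const \<tau> = - \<i> * exp (2 * pi * \<i> * \<tau> / 8)"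

lemma theta1_const_nonzero: "theta1_const \<tau> \<noteq> 0"
  by (simp add: theta1_const_def)

lemma theta1_eq:
  assumes "Im \<tau> > 0"
  shows "theta1 z \<tau> = theta1_const \<tau> * exp (- (pi * \<i> * z)) * theta_mult (qvar \<tau>) (pvar z)"
proof -
  have q: "norm (qvar \<tau>) < 1" using assms by (simp add: norm_qvar)
  have conv: "convergent_prod (\<lambda>m. 1 - c * qvar \<tau> ^ Suc m)" for c
    using convergent_prod_qpoch[OF q, of "c * qvar \<tau>"] by (simp add: mult.assoc)
  have qp: "qpoch (qvar \<tau>) (c * qvar \<tau>) = (\<Prod>m. 1 - c * qvar \<tau> ^ Suc m)" for c
    by (simp add: qpoch_def mult.assoc)
  have "theta_prod (qvar \<tau>) (pvar z) =
      (\<Prod>m. 1 - 1 * qvar \<tau> ^ Suc m) * (\<Prod>m. 1 - pvar z * qvar \<tau> ^ Suc m) *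
      (\<Prod>m. 1 - inverse (pvar z) * qvar \<tau> ^ Suc m)"
    unfolding theta_prod_def qp[symmetric] by (simp add: field_simps)
  also have "\<dots> = (\<Prod>m. (1 - 1 * qvar \<tau> ^ Suc m) * (1 - pvar z * qvar \<tau> ^ Suc m) *
            (1 - inverse (pvar z) * qvar \<tau> ^ Suc m))"
    by (subst prodinf_mult, (intro conv convergent_prod_mult)+)+ simp
  finally have "theta_prod (qvar \<tau>) (pvar z) = (\<Prod>m. (1 - qvar \<tau> ^ Suc m) *
      (1 - pvar z * qvar \<tau> ^ Suc m) * (1 - inverse (pvar z) * qvar \<tau> ^ Suc m))"
    by simp
  moreover have "exp (pi * \<i> * z) - exp (- (pi * \<i> * z)) = exp (- (pi * \<i> * z)) * (pvar z - 1)"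
    by (simp add: pvar_def algebra_simps flip: exp_add)
  ultimately show ?thesis
    unfolding theta1_def theta_mult_def theta1_const_def by simp
qed

lemma theta1_holomorphic:
  assumes "Im \<tau> > 0"
  shows "(\<lambda>z. theta1 z \<tau>) holomorphic_on UNIV"
proof -
  have "norm (qvar \<tau>) < 1" using assms by (simp add: norm_qvar)
  then show ?thesis
    unfolding theta1_eq[OF assms] theta_mult_def pvar_def
    by (intro holomorphic_intros
        holomorphic_on_compose_gen[OF _ theta_prod_holomorphic, unfolded comp_def]) auto
qed

text \<open>In the strip \<open>theta_prod\<close> has no zeros, so only the factor
  \<open>p - 1\<close> can vanish.\<close>

lemma theta1_eq_0_iff:
  assumes "\<bar>Im z\<bar> < Im \<tau>"
  shows "theta1 z \<tau> = 0 \<longleftrightarrow> z \<in> \<int>"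
proof -
  have "theta_prod (qvar \<tau>) (pvar z) \<noteq> 0"
    using assms pvar_in_annulus[OF assms] by (intro theta_prod_nonzero) (auto simp: norm_qvar)
  moreover have "Im \<tau> > 0" using assms by linarith
  ultimately show ?thesis
    by (simp add: theta1_eq theta_mult_def theta1_const_nonzero pvar_eq_1_iff)
qed

text \<open>Rescaling the variable by 1/(2 pi i) turns ordinary derivatives into bullet
  derivatives.\<close>

lemma theta1_has_fps_expansion:
  assumes "Im \<tau> > 0"
  shows "(\<lambda>w. theta1 (z + w / (2 * pi * \<i>)) \<tau>) has_fps_expansion
    Abs_fps (\<lambda>k. theta1_bullet k z \<tau> / fact k)"
proof -
  define u where "u = 1 / (2 * pi * \<i>)"
  have holo: "(\<lambda>w. theta1 (u * w + z) \<tau>) holomorphic_on UNIV"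
    by (rule holomorphic_on_compose_gen[OF _ theta1_holomorphic[OF assms], unfolded comp_def])
      (auto intro!: holomorphic_intros)
  have "(deriv ^^ k) (\<lambda>w. theta1 (u * w + z) \<tau>) 0 = theta1_bullet k z \<tau>" for k
    by (subst higher_deriv_compose_linear'[OF theta1_holomorphic[OF assms], of UNIV])
      (auto simp: theta1_bullet_def u_def)
  moreover have "(\<lambda>w. theta1 (u * w + z) \<tau>) has_fps_expansion fps_expansion (\<lambda>w. theta1 (u * w + z) \<tau>) 0"
    by (rule has_fps_expansion_fps_expansion[OF _ _ holo]) auto
  ultimately show ?thesis
    by (simp add: fps_expansion_def u_def add.commute)
qed

lemma theta1_bullet_1_0:
  assumes "Im \<tau> > 0"
  shows "theta1_bullet 1 0 \<tau> = theta1_const \<tau> * theta_prod (qvar \<tau>) 1"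
proof -
  let ?g = "\<lambda>z. theta1_const \<tau> * exp (- (pi * \<i> * z)) * theta_prod (qvar \<tau>) (pvar z)"
  have q: "norm (qvar \<tau>) < 1" using assms by (simp add: norm_qvar)
  have "?g holomorphic_on UNIV"
    unfolding pvar_def using q
    by (intro holomorphic_intros
        holomorphic_on_compose_gen[OF _ theta_prod_holomorphic, unfolded comp_def]) auto
  then obtain d where d: "(?g has_field_derivative d) (at 0)"
    by (auto simp: holomorphic_on_def field_differentiable_def)
  have "((\<lambda>z. pvar z - 1) has_field_derivative (2 * pi * \<i>)) (at 0)"
    unfolding pvar_def by (auto intro!: derivative_eq_intros)
  from DERIV_mult[OF this d]
  have "((\<lambda>z. (pvar z - 1) * ?g z) has_field_derivative (2 * pi * \<i>) * ?g 0) (at 0)"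
    by (simp add: pvar_def mult_ac)
  moreover have "(\<lambda>z. (pvar z - 1) * ?g z) = (\<lambda>z. theta1 z \<tau>)"
    by (simp add: theta1_eq[OF assms] theta_mult_def mult_ac)
  ultimately have "deriv (\<lambda>z. theta1 z \<tau>) 0 = (2 * pi * \<i>) * ?g 0"
    by (intro DERIV_imp_deriv) (simp only:)
  then show ?thesis by (simp add: theta1_bullet_def pvar_def)
qed

lemma theta1_bullet_1_0_nonzero:
  assumes "Im \<tau> > 0"
  shows "theta1_bullet 1 0 \<tau> \<noteq> 0"
  unfolding theta1_bullet_1_0[OF assms]
  using theta_prod_nonzero[of "qvar \<tau>" 1] theta1_const_nonzero assms by (simp add: norm_qvar)

definition theta1_fps :: "complex \<Rightarrow> complex \<Rightarrow> complex fps" where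
  "theta1_fps z \<tau> = Abs_fps (\<lambda>k. theta1_bullet k z \<tau> / fact k)"

lemma theta1_fps_0:
  assumes "Im \<tau> > 0"
  shows "theta1_fps 0 \<tau> = fps_X * fps_shift 1 (theta1_fps 0 \<tau>)"
proof -
  have "theta1 0 \<tau> = 0" by (simp add: theta1_def)
  then have "fps_nth (theta1_fps 0 \<tau>) 0 = 0" by (simp add: theta1_fps_def theta1_bullet_def)
  then show ?thesis by (intro fps_ext) simp
qed

text \<open>Since \<open>theta1\<close> has a simple zero at 0, its series is \<open>w\<close> times
  a unit; the factor \<open>1 / w\<close> accounts for the index \<open>int n - 1\<close>.\<close>

lemma h_tilde_eq:
  assumes "Im \<tau> > 0"
  shows "h_tilde n \<tau> = fps_nth (inverse (fps_shift 1 (theta1_fps 0 \<tau>))) n"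
proof -
  define T where "T = fps_shift 1 (theta1_fps 0 \<tau>)"
  have "fps_nth T 0 \<noteq> 0"
    using theta1_bullet_1_0_nonzero[OF assms] by (simp add: T_def theta1_fps_def)
  then have T: "T * inverse T = 1" by (simp add: inverse_mult_eq_1')
  have "(\<lambda>w. theta1 (w / (2 * pi * \<i>)) \<tau>) has_laurent_expansion fps_to_fls (fps_X * T)"
    using has_laurent_expansion_fps[OF theta1_has_fps_expansion[OF assms, of 0]]
      theta1_fps_0[OF assms] by (simp add: T_def theta1_fps_def)
  then have "laurent_expansion (\<lambda>w. 1 / theta1 (w / (2 * pi * \<i>)) \<tau>) 0 = inverse (fps_to_fls (fps_X * T))"
    by (intro laurent_expansion_0_eqI)
      (use has_laurent_expansion_inverse in \<open>simp add: inverse_eq_divide\<close>)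
  also have "\<dots> = fls_X_inv * fps_to_fls (inverse T)"
  proof (rule inverse_unique)
    have "fps_to_fls (fps_X * T) * (fls_X_inv * fps_to_fls (inverse T)) =
        (fls_X * fls_X_inv) * fps_to_fls (T * inverse T)"
      by (simp only: fls_times_fps_to_fls fps_X_to_fls mult_ac)
    also have "\<dots> = 1"
      by (simp add: T fls_X_inv_times_conv_shift)
    finally show "fps_to_fls (fps_X * T) * (fls_X_inv * fps_to_fls (inverse T)) = 1" .
  qed
  finally show ?thesis
    by (simp add: h_tilde_def T_def fls_X_inv_times_conv_shift)
qed

section \<open>Bernoulli numbers and the series \<open>J_series\<close>\<close>

lemma bernoulli_num_eq:
  "bernoulli_num n = fact n * fps_nth (inverse (fps_shift 1 (fps_exp 1 - 1))) n"
proof -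
  define E where "E = fps_shift 1 (fps_exp 1 - 1 :: complex fps)"
  have "fps_exp 1 - 1 = fps_X * E"
    unfolding E_def by (intro fps_ext) simp
  then have "fps_X / (fps_exp 1 - 1) = (fps_X * 1) / (fps_X * E)"
    by simp
  also have "\<dots> = 1 / E"
    by (rule div_mult_mult1) simp
  also have "\<dots> = inverse E"
    by (simp add: fps_divide_unit E_def)
  finally show ?thesis by (simp add: bernoulli_num_def E_def)
qed

lemma J_series_eq:
  assumes z: "\<bar>Im z\<bar> < Im \<tau>"
  shows "J_series n z \<tau> = (if n = 1 then pvar z / (pvar z - 1) else 0) + bernoulli_num n
    - of_nat n * (lambert_moment (n - 1) (pvar z) (qvar \<tau>) +
        (- 1) ^ n * lambert_moment (n - 1) (1 / pvar z) (qvar \<tau>))"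
proof -
  let ?p = "pvar z" and ?q = "qvar \<tau>"
  have q: "?q \<noteq> 0" "norm ?q < 1" using z by (auto simp: qvar_def)
  have p: "norm ?p * norm ?q < 1" "norm (inverse ?p) * norm ?q < 1"
    using pvar_in_annulus[OF z] by (auto simp: norm_inverse norm_divide inverse_eq_divide divide_less_eq)
  have "((\<lambda>x. (case x of (k, r) \<Rightarrow> of_nat r ^ (n - 1) * ?p ^ k * ?q ^ (k * r)) +
      (- 1) ^ n * (case x of (k, r) \<Rightarrow> of_nat r ^ (n - 1) * inverse ?p ^ k * ?q ^ (k * r))) has_sum
      (lambert_moment (n - 1) ?p ?q + (- 1) ^ n * lambert_moment (n - 1) (inverse ?p) ?q)) ({1..} \<times> {1..})"
    by (intro has_sum_add has_sum_cmult_right has_sum_lambert_moment q p)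
  also have "(\<lambda>x. (case x of (k, r) \<Rightarrow> of_nat r ^ (n - 1) * ?p ^ k * ?q ^ (k * r)) +
      (- 1) ^ n * (case x of (k, r) \<Rightarrow> of_nat r ^ (n - 1) * inverse ?p ^ k * ?q ^ (k * r))) =
    (\<lambda>(k, r). of_nat r ^ (n - 1) * (?p ^ k + (- 1) ^ n * inverse ?p ^ k) * ?q ^ (k * r))"
    by (simp add: fun_eq_iff algebra_simps)
  finally show ?thesis
    unfolding J_series_def by (subst infsumI, assumption) (simp add: inverse_eq_divide)
qed

lemma F_eq_J_series:
  assumes z: "\<bar>Im z\<bar> < Im \<tau>" "z \<notin> \<int>"
  shows "F n z \<tau> = J_series n z \<tau>"
proof -
  define p q where "p = pvar z" and "q = qvar \<tau>"
  have \<tau>: "Im \<tau> > 0" using z by linarith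
  have q: "q \<noteq> 0" "norm q < 1" using \<tau> by (auto simp: q_def qvar_def)
  have p: "norm q < norm p" "norm p * norm q < 1" "p \<noteq> 1"
    using pvar_in_annulus[OF z(1)] z(2) by (auto simp: p_def q_def pvar_eq_1_iff)
  have p': "norm (1 / p) * norm q < 1"
    using p q by (auto simp: norm_divide divide_less_eq)
  define \<theta> b where "\<theta> = theta1 z \<tau>" and "b = theta1_bullet 1 0 \<tau>"
  have "\<theta> \<noteq> 0" using theta1_eq_0_iff[OF z(1)] z(2) by (simp add: \<theta>_def)
  define R where "R y = p / (p - 1) - lambert p q y + lambert (1 / p) q (1 / y)" for y
  \<comment> \<open>Kronecker's identity in \<open>w\<close>, without denominators, so that it holds
    on a full neighbourhood of \<open>w = 0\<close>.\<close>
  have functional: "b * theta1 (z + w / (2 * pi * \<i>)) \<tau> * (exp w - 1) =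
      \<theta> * theta1 (0 + w / (2 * pi * \<i>)) \<tau> * (1 + (exp w - 1) * R (exp w))"
    if "norm q < norm (exp w)" "norm (exp w) * norm q < 1" for w
  proof -
    have y: "pvar (w / (2 * pi * \<i>)) = exp w" by (simp add: pvar_def)
    have e: "exp (- (pi * \<i> * (z + w / (2 * pi * \<i>)))) =
        exp (- (pi * \<i> * z)) * exp (- (pi * \<i> * (w / (2 * pi * \<i>))))"
      by (simp only: exp_add[symmetric] ring_distribs minus_add_distrib)
    have "theta_prod q 1 * theta_mult q (p * exp w) =
        theta_mult q p * theta_prod q (exp w) * (1 + (exp w - 1) * R (exp w))"
      unfolding R_def by (rule kronecker_identity) (use q p that in auto)
    then show ?thesis
      unfolding b_def \<theta>_def theta1_bullet_1_0[OF \<tau>] theta1_eq[OF \<tau>] pvar_add add_0 y e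
      unfolding p_def[symmetric] q_def[symmetric] theta_mult_def[of q "exp w"]
      by algebra
  qed
  define E where "E = fps_shift 1 (fps_exp 1 - 1 :: complex fps)"
  define T where "T = fps_shift 1 (theta1_fps 0 \<tau>)"
  define RR where "RR = fps_const (p / (p - 1)) -
      Abs_fps (\<lambda>j. 1 ^ j * lambert_moment j p q / fact j) +
      Abs_fps (\<lambda>j. (- 1) ^ j * lambert_moment j (1 / p) q / fact j)"
  have X_E: "fps_exp 1 - 1 = fps_X * E"
    unfolding E_def by (intro fps_ext) simp
  have inv: "E * inverse E = 1" "T * inverse T = 1"
    using theta1_bullet_1_0_nonzero[OF \<tau>]
    by (auto intro!: inverse_mult_eq_1' simp: E_def T_def theta1_fps_def)
  have exp_fps: "(\<lambda>w. exp w - 1) has_fps_expansion fps_X * E"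
    unfolding X_E[symmetric] by (intro fps_expansion_intros)
  have R_fps: "(\<lambda>w. R (exp w)) has_fps_expansion RR"
    using lambert_exp_has_fps_expansion[OF q p(2), of 1] lambert_exp_has_fps_expansion[OF q p', of "-1"]
    unfolding R_def RR_def
    by (intro has_fps_expansion_add has_fps_expansion_diff has_fps_expansion_const)
      (simp_all add: exp_minus inverse_eq_divide)
  have theta_fps: "(\<lambda>w. theta1 (u + w / (2 * pi * \<i>)) \<tau>) has_fps_expansion theta1_fps u \<tau>" for u
    unfolding theta1_fps_def by (rule theta1_has_fps_expansion[OF \<tau>])
  have lhs: "(\<lambda>w. b * theta1 (z + w / (2 * pi * \<i>)) \<tau> * (exp w - 1)) has_fps_expansion
      fps_const b * theta1_fps z \<tau> * (fps_X * E)"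
    by (intro has_fps_expansion_mult has_fps_expansion_const theta_fps exp_fps)
  have rhs: "(\<lambda>w. \<theta> * theta1 (0 + w / (2 * pi * \<i>)) \<tau> * (1 + (exp w - 1) * R (exp w))) has_fps_expansion
      fps_const \<theta> * theta1_fps 0 \<tau> * (1 + fps_X * E * RR)"
    by (intro has_fps_expansion_mult has_fps_expansion_add has_fps_expansion_const has_fps_expansion_1
        theta_fps exp_fps R_fps)
  have "open {w. norm q < norm (exp w :: complex)}" "open {w. norm (exp w :: complex) * norm q < 1}"
    by (intro open_Collect_less continuous_intros)+
  then have "eventually (\<lambda>w. norm q < norm (exp w) \<and> norm (exp w) * norm q < 1) (nhds (0 :: complex))"
    using q by (intro eventually_conj) (auto dest!: eventually_nhds_in_open[of _ "0 :: complex"])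
  then have ev: "eventually (\<lambda>w. b * theta1 (z + w / (2 * pi * \<i>)) \<tau> * (exp w - 1) =
      \<theta> * theta1 (0 + w / (2 * pi * \<i>)) \<tau> * (1 + (exp w - 1) * R (exp w))) (nhds 0)"
    by (rule eventually_mono) (rule functional, simp_all)
  have "fps_const b * theta1_fps z \<tau> * (fps_X * E) =
      fps_const \<theta> * theta1_fps 0 \<tau> * (1 + fps_X * E * RR)"
    by (rule fps_expansion_unique_complex[OF lhs])
      (rule has_fps_expansion_cong[OF ev refl, THEN iffD2, OF rhs])
  \<comment> \<open>The simple zero of \<open>theta1\<close> at 0 supplies the factor
    \<open>w\<close> on the right that cancels the one of \<open>exp w - 1\<close> on the
    left.\<close>
  then have "fps_X * (E * (fps_const b * theta1_fps z \<tau>)) =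
      fps_X * (fps_const \<theta> * T * (1 + fps_X * E * RR))"
    by (subst (asm) theta1_fps_0[OF \<tau>]) (simp add: T_def mult_ac)
  then have "E * (fps_const b * theta1_fps z \<tau>) = fps_const \<theta> * T * (1 + fps_X * E * RR)"
    by simp
  then have "(E * inverse E) * inverse T * (fps_const b * theta1_fps z \<tau>) =
      (T * inverse T) * fps_const \<theta> * (inverse E + fps_X * (E * inverse E) * RR)"
    by algebra
  \<comment> \<open>The two generating functions, multiplied by \<theta>: the left side yields the
    \<open>F n\<close>, while \<open>inverse E\<close> yields the Bernoulli numbers and
    \<open>fps_X * RR\<close> the remaining terms of \<open>J_series\<close>.\<close>
  then have main: "fps_const b * (theta1_fps z \<tau> * inverse T) = fps_const \<theta> * (inverse E + fps_X * RR)"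
    by (simp add: inv mult_ac)
  have "\<theta> * F n z \<tau> = (\<Sum>k=0..n. of_nat (n choose k) * h_coeff (n - k) \<tau> * theta1_bullet k z \<tau>)"
    using \<open>\<theta> \<noteq> 0\<close> by (simp add: F_def \<theta>_def)
  \<comment> \<open>Splitting the binomial coefficient into factorials turns the defining sum of
    \<open>F\<close> into a Cauchy product.\<close>
  also have "\<dots> = (\<Sum>k=0..n. fact n * (b * (fps_nth (theta1_fps z \<tau>) k * fps_nth (inverse T) (n - k))))"
  proof (intro sum.cong refl)
    fix k assume "k \<in> {0..n}"
    then have choose: "of_nat (n choose k) = (fact n / (fact k * fact (n - k)) :: complex)"
      by (intro binomial_fact) simp
    have coeff: "fps_nth (theta1_fps z \<tau>) k = theta1_bullet k z \<tau> / fact k"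
      by (simp add: theta1_fps_def)
    show "of_nat (n choose k) * h_coeff (n - k) \<tau> * theta1_bullet k z \<tau> =
        fact n * (b * (fps_nth (theta1_fps z \<tau>) k * fps_nth (inverse T) (n - k)))"
      unfolding choose coeff h_coeff_def h_tilde_eq[OF \<tau>] T_def[symmetric] b_def[symmetric] by simp
  qed
  also have "\<dots> = fact n * fps_nth (fps_const b * (theta1_fps z \<tau> * inverse T)) n"
    unfolding fps_mult_left_const_nth by (simp only: fps_mult_nth sum_distrib_left)
  also have "\<dots> = \<theta> * (fact n * fps_nth (inverse E) n + fact n * fps_nth (fps_X * RR) n)"
    unfolding main by (simp add: algebra_simps)
  also have "fact n * fps_nth (inverse E) n = bernoulli_num n"
    by (simp add: bernoulli_num_eq E_def)
  also have "fact n * fps_nth (fps_X * RR) n = (if n = 1 then p / (p - 1) else 0)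
    - of_nat n * (lambert_moment (n - 1) p q + (- 1) ^ n * lambert_moment (n - 1) (1 / p) q)"
  \<comment> \<open>For \<open>n = 0\<close> both sides vanish. For \<open>n = Suc m\<close> the
    factor \<open>n\<close> comes from \<open>fact n = n * fact m\<close>, and the sign from
    \<open>(-1) ^ m = - (-1) ^ n\<close>.\<close>
  proof (cases n)
    case (Suc m)
    have "fact m * fps_nth RR m =
        (if m = 0 then p / (p - 1) else 0) - lambert_moment m p q + (- 1) ^ m * lambert_moment m (1 / p) q"
      by (simp add: RR_def ring_distribs)
    then have "of_nat n * (fact m * fps_nth RR m) = of_nat n *
        ((if m = 0 then p / (p - 1) else 0) - lambert_moment m p q + (- 1) ^ m * lambert_moment m (1 / p) q)"
      by simp
    then show ?thesis unfolding Suc by (simp add: algebra_simps)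
  qed simp
  finally have "\<theta> * F n z \<tau> = \<theta> * J_series n z \<tau>"
    unfolding J_series_eq[OF z(1)] p_def q_def add_diff_eq by (simp only: add.commute)
  then show ?thesis using \<open>\<theta> \<noteq> 0\<close> by simp
qed

theorem theorem3p1:
  fixes \<tau> :: complex and n :: nat
  assumes "Im \<tau> > 0"
  shows "remove_sings (\<lambda>z. F n z \<tau>) = (\<lambda>z. J n z \<tau>) \<and>
         (\<forall>z. theta1 z \<tau> \<noteq> 0 \<longrightarrow> F n z \<tau> = J n z \<tau>)"
proof -
  let ?F = "\<lambda>z. F n z \<tau>"
  have theta: "(\<lambda>z. theta1 z \<tau>) analytic_on A" for A
    using theta1_holomorphic[OF assms] analytic_on_holomorphic by blast
  have bullet: "(\<lambda>z. theta1_bullet k z \<tau>) analytic_on A" for k A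
    unfolding theta1_bullet_def by (intro analytic_intros analytic_higher_deriv theta)
  have "?F meromorphic_on UNIV"
    unfolding F_def by (intro meromorphic_intros analytic_on_imp_meromorphic_on theta bullet)
  then have nice: "remove_sings ?F nicely_meromorphic_on UNIV"
    by (rule remove_sings_nicely_meromorphic)
  have remove: "remove_sings ?F z = F n z \<tau>" if "theta1 z \<tau> \<noteq> 0" for z
  proof (rule remove_sings_at_analytic)
    show "?F analytic_on {z}"
      unfolding F_def by (intro analytic_intros theta bullet) (use that in auto)
  qed
  \<comment> \<open>In the strip \<open>theta1\<close> vanishes only at integers, so elsewhere in it
    \<open>remove_sings\<close> leaves \<open>F\<close> unchanged and the comparison with
    \<open>J_series\<close> applies.\<close>
  have "is_J_continuation n \<tau> (remove_sings ?F)"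
    unfolding is_J_continuation_def
    using nice remove theta1_eq_0_iff F_eq_J_series by auto
  then have "(THE f. is_J_continuation n \<tau> f) = remove_sings ?F"
    using is_J_continuation_unique[OF assms] by blast
  then have "remove_sings ?F = (\<lambda>z. J n z \<tau>)"
    by (simp add: J_def)
  then show ?thesis
    using remove by metis
qed

end
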